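(* Let $\mathcal{X}=\{1,\dots,m\}$, let $q$ be a positive measure on $\mathcal{X}$ with full support, and let $A\in\mathbb{R}^{d\times m}$ be a matrix whose row span contains $(1,\dots,1)$. Let $S$ be a nonempty subset of $\mathcal{X}$. Then $S\in\mathcal{S}_{q,A}:=\{\operatorname{supp}(p): p\in\overline{\mathcal{E}_{q,A}}\}$ if and only if the following holds for all signed circuits $(M,N)\in\mathcal{C}(A)$: $$M\subseteq S\quad\Longleftrightarrow\quad N\subseteq S .$$
   Context: $\mathcal{P}(\mathcal{X})$ is the open simplex of probability measures with full support on $\mathcal{X}$, viewed as a subset of $\mathbb{R}^{\mathcal{X}}$; closures are taken in the standard topology of $\mathbb{R}^{\mathcal{X}}$. The columns of $A$ are denoted $a_x\in\mathbb{R}^d$, $x\in\mathcal{X}$. The exponential family associated with $q$ and $A$ is $$\mathcal{E}_{q,A}=\Big\{p_\theta\in\mathcal{P}(\mathcal{X}) : p_\theta(x)=\frac{q(x)}{Z_\theta}\exp(\theta^{T}a_x),\ \theta\in\mathbb{R}^d\Big\},\qquad Z_\theta=\sum_{x\in\mathcal{X}}q(x)\exp(\theta^{T}a_x).$$ For $n\in\mathbb{R}^{\mathcal{X}}$ put $n^{+}(x)=\max(n(x),0)$, $n^{-}(x)=\max(-n(x),0)$ and $\operatorname{supp}(n)=\{x:n(x)\neq0\}$. A circuit vector of $A$ is a nonzero vector $n\in\ker A$ with inclusion-minimal support, i.e. if $n'\in\ker A$ satisfies $\operatorname{supp}(n')\subseteq\operatorname{supp}(n)$, then $n'=\lambda n$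 for some $\lambda\in\mathbb{R}$. For $n\in\mathbb{R}^{\mathcal{X}}$ let $\operatorname{sgn}(n)=(\operatorname{supp}(n^{+}),\operatorname{supp}(n^{-}))$, a pair of disjoint subsets of $\mathcal{X}$. The set of signed circuits of $A$ is $\mathcal{C}(A)=\{\operatorname{sgn}(c): c \text{ a circuit vector of } A\}$. *)

theory Defs
  imports "HOL-Analysis.Analysis"
begin

text \<open>
  The finite set \<open>X\<close> with \<open>m\<close> elements is the universe of the finite type \<open>'m\<close>. Measures on \<open>X\<close>
  are vectors in \<open>real ^ 'm\<close>, and a \<open>d\<close> by \<open>m\<close> matrix has type \<open>real ^ 'm ^ 'd\<close>.
\<close>

definition supp :: "real ^ 'm \<Rightarrow> 'm set" where
  "supp v = {x. v $ x \<noteq> 0}"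

definition pos_part :: "real ^ 'm \<Rightarrow> real ^ 'm" where
  "pos_part v = (\<chi> x. max (v $ x) 0)"

definition neg_part :: "real ^ 'm \<Rightarrow> real ^ 'm" where
  "neg_part v = (\<chi> x. max (- (v $ x)) 0)"

definition sgn_pair :: "real ^ 'm \<Rightarrow> 'm set \<times> 'm set" where
  "sgn_pair v = (supp (pos_part v), supp (neg_part v))"

text \<open>The open probability simplex: only measures with full support.\<close>

definition prob_simplex :: "(real ^ 'm::finite) set" where
  "prob_simplex = {p. (\<forall>x. p $ x > 0) \<and> (\<Sum>x\<in>UNIV. p $ x) = 1}"

definition partition_fun :: "real ^ 'm::finite \<Rightarrow> real ^ 'm ^ 'd::finite \<Rightarrow> real ^ 'd \<Rightarrow> real" where
  "partition_fun q A \<theta> = (\<Sum>x\<in>UNIV. q $ x * exp (\<theta> \<bullet> column x A))"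

definition exp_family :: "real ^ 'm::finite \<Rightarrow> real ^ 'm ^ 'd::finite \<Rightarrow> (real ^ 'm) set" where
  "exp_family q A = {p \<in> prob_simplex.
     \<exists>\<theta>. \<forall>x. p $ x = q $ x / partition_fun q A \<theta> * exp (\<theta> \<bullet> column x A)}"

definition support_sets :: "real ^ 'm::finite \<Rightarrow> real ^ 'm ^ 'd::finite \<Rightarrow> 'm set set" where
  "support_sets q A = supp ` closure (exp_family q A)"

definition mat_ker :: "real ^ 'm::finite ^ 'd::finite \<Rightarrow> (real ^ 'm) set" where
  "mat_ker A = {n. A *v n = 0}"

definition circuit_vector :: "real ^ 'm::finite ^ 'd::finite \<Rightarrow> real ^ 'm \<Rightarrow> bool" where
  "circuit_vector A n \<longleftrightarrow> n \<in> mat_ker A \<and> n \<noteq> 0 \<and>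
     (\<forall>n'\<in>mat_ker A. supp n' \<subseteq> supp n \<longrightarrow> (\<exists>c. n' = c *\<^sub>R n))"

definition signed_circuits :: "real ^ 'm::finite ^ 'd::finite \<Rightarrow> ('m set \<times> 'm set) set" where
  "signed_circuits A = {sgn_pair n | n. circuit_vector A n}"

end

theory Submission
  imports Defs
begin

text \<open>
  Both directions pass through the kernel of \<open>A\<close>.

  Necessity. Since the constant vector lies in the row span, the coordinates of any \<open>n\<close> in the
  kernel sum to zero, so both \<open>\<theta>\<close> and the normalising constant drop out of the \<open>n\<close>-weighted sum of
  \<open>ln (p x / q x)\<close>, for every \<open>p\<close> in the family. Exponentiating gives the binomial equation
  \<open>\<Prod>\<^sub>M (p / q) powr n = \<Prod>\<^sub>N (p / q) powr (- n)\<close>, where \<open>M\<close> and \<open>N\<close> carry the positive and the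
  negative coordinates of \<open>n\<close>. All exponents are positive, so the equation survives passage to the
  closure (\<open>closure_binomial_equation\<close>); there one side vanishes iff the other does, which is to
  say that \<open>M\<close> lies in the support of \<open>p\<close> iff \<open>N\<close> does.

  Sufficiency. If some linear functional \<open>\<theta>\<close> is zero on the columns indexed by \<open>S\<close> and positive on
  all others, then moving to infinity in direction \<open>- \<theta>\<close> makes the members of the family converge to
  the normalised restriction of \<open>q\<close> to \<open>S\<close> (\<open>face_in_support_sets\<close>). If there is no such \<open>\<theta>\<close>, a
  separation argument (\<open>face_functional_or_kernel_vector\<close>) yields a kernel vector that is
  nonnegative outside \<open>S\<close> and not identically zero there. One of minimal support turns out to be a
  circuit vector (\<open>circuit_of_kernel_vector\<close>); its negative part lies in \<open>S\<close> but its positive part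
  does not, so the circuit condition fails.
\<close>

section \<open>Binomial equations on the closure of the family\<close>

lemma supp_pos_part: "supp (pos_part n) = {x. n $ x > 0}"
  by (auto simp: supp_def pos_part_def max_def)

lemma supp_neg_part: "supp (neg_part n) = {x. n $ x < 0}"
  by (auto simp: supp_def neg_part_def max_def)

lemma kernel_sum_eq_0:
  fixes A :: "real ^ 'm::finite ^ 'd::finite"
  assumes "(\<chi> x. 1) \<in> span (rows A)" and "n \<in> mat_ker A"
  shows "(\<Sum>x\<in>UNIV. n $ x) = 0"
proof -
  have "orthogonal n r" if r: "r \<in> rows A" for r
  proof -
    obtain i where "r = row i A" using r by (auto simp: rows_def)
    moreover have "(A *v n) $ i = 0" using assms(2) by (simp add: mat_ker_def)
    ultimately show ?thesis
      by (simp add: orthogonal_def matrix_vector_mul_component row_def inner_commute)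
  qed
  then have "orthogonal n (\<chi> x. 1)"
    using orthogonal_to_span[OF assms(1)] by blast
  then show ?thesis by (simp add: orthogonal_def inner_vec_def)
qed

lemma kernel_inner_columns:
  fixes A :: "real ^ 'm::finite ^ 'd::finite"
  assumes "n \<in> mat_ker A"
  shows "(\<Sum>x\<in>UNIV. n $ x * (\<theta> \<bullet> column x A)) = 0"
proof -
  have "(\<Sum>x\<in>UNIV. n $ x * (\<theta> \<bullet> column x A)) = \<theta> \<bullet> (A *v n)"
    by (simp add: matrix_mult_sum inner_sum_right scalar_mult_eq_scaleR)
  then show ?thesis using assms by (simp add: mat_ker_def)
qed

lemma partition_fun_pos:
  assumes "\<And>x. q $ x > 0"
  shows "partition_fun q A \<theta> > 0"
  unfolding partition_fun_def by (rule sum_pos) (use assms in auto)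

text \<open>On the family, \<open>p / q\<close> is the exponential of a function orthogonal to \<open>n\<close>; the two products
  collect the positive and the negative terms of that orthogonality relation.\<close>

lemma exp_family_binomial_equation:
  fixes A :: "real ^ 'm::finite ^ 'd::finite"
  assumes q: "\<And>x. q $ x > 0" and one: "(\<chi> x. 1) \<in> span (rows A)"
    and n: "n \<in> mat_ker A" and p: "p \<in> exp_family q A"
  shows "(\<Prod>x | n $ x > 0. (p $ x / q $ x) powr (n $ x))
       = (\<Prod>x | n $ x < 0. (p $ x / q $ x) powr (- (n $ x)))"
proof -
  obtain \<theta> where \<theta>: "\<And>x. p $ x = q $ x / partition_fun q A \<theta> * exp (\<theta> \<bullet> column x A)"
    using p by (auto simp: exp_family_def)
  define u where "u x = \<theta> \<bullet> column x A - ln (partition_fun q A \<theta>)" for x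
  have ratio: "p $ x / q $ x = exp (u x)" for x
    using q[of x] partition_fun_pos[of q A \<theta>, OF q] by (simp add: \<theta> u_def exp_diff)
  have "(\<Sum>x\<in>UNIV. n $ x * u x) = (\<Sum>x\<in>UNIV. n $ x * (\<theta> \<bullet> column x A))
      - (\<Sum>x\<in>UNIV. n $ x) * ln (partition_fun q A \<theta>)"
    by (simp add: u_def algebra_simps sum_subtractf sum_distrib_right)
  also have "\<dots> = 0"
    using kernel_sum_eq_0[OF one n] kernel_inner_columns[OF n] by simp
  finally have "(\<Sum>x\<in>UNIV. n $ x * u x) = 0" .
  moreover have "(\<Sum>x\<in>UNIV. n $ x * u x)
      = (\<Sum>x\<in>{x. n $ x > 0} \<union> {x. n $ x < 0}. n $ x * u x)"
    by (rule sum.mono_neutral_right) auto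
  moreover have "\<dots> = (\<Sum>x | n $ x > 0. n $ x * u x) + (\<Sum>x | n $ x < 0. n $ x * u x)"
    by (rule sum.union_disjoint) auto
  ultimately have "(\<Sum>x | n $ x > 0. n $ x * u x) = (\<Sum>x | n $ x < 0. - (n $ x) * u x)"
    by (simp add: sum_negf)
  then show ?thesis
    by (simp add: ratio powr_def flip: exp_sum)
qed

text \<open>Restricting the products to the coordinates with nonzero exponent is what makes them
  continuous up to the boundary, where coordinates of \<open>p\<close> may vanish.\<close>

lemma closure_binomial_equation:
  fixes A :: "real ^ 'm::finite ^ 'd::finite"
  assumes q: "\<And>x. q $ x > 0" and one: "(\<chi> x. 1) \<in> span (rows A)"
    and n: "n \<in> mat_ker A" and p: "p \<in> closure (exp_family q A)"
  shows "(\<Prod>x | n $ x > 0. (p $ x / q $ x) powr (n $ x))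
       = (\<Prod>x | n $ x < 0. (p $ x / q $ x) powr (- (n $ x)))"
proof -
  obtain f where f: "\<And>k. f k \<in> exp_family q A" and lim: "f \<longlonglongrightarrow> p"
    using p by (auto simp: closure_sequential)
  have f_pos: "f k $ x / q $ x \<ge> 0" for k x
    using f[of k] q[of x] by (simp add: exp_family_def prob_simplex_def less_imp_le)
  have lim_x: "(\<lambda>k. f k $ x / q $ x) \<longlonglongrightarrow> p $ x / q $ x" for x
    using q[of x] by (intro tendsto_intros lim) auto
  have powr_lim: "(\<lambda>k. (f k $ x / q $ x) powr a) \<longlonglongrightarrow> (p $ x / q $ x) powr a" if "a > 0" for x a
    by (rule tendsto_powr'[OF lim_x tendsto_const]) (use that f_pos in auto)
  have "(\<lambda>k. \<Prod>x | n $ x > 0. (f k $ x / q $ x) powr (n $ x))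
      \<longlonglongrightarrow> (\<Prod>x | n $ x > 0. (p $ x / q $ x) powr (n $ x))"
    by (intro tendsto_prod powr_lim) auto
  moreover have "(\<lambda>k. \<Prod>x | n $ x < 0. (f k $ x / q $ x) powr (- (n $ x)))
      \<longlonglongrightarrow> (\<Prod>x | n $ x < 0. (p $ x / q $ x) powr (- (n $ x)))"
    by (intro tendsto_prod powr_lim) auto
  ultimately show ?thesis
    unfolding exp_family_binomial_equation[OF q one n f] by (rule LIMSEQ_unique)
qed

lemma support_sets_kernel_condition:
  fixes A :: "real ^ 'm::finite ^ 'd::finite"
  assumes q: "\<And>x. q $ x > 0" and one: "(\<chi> x. 1) \<in> span (rows A)"
    and n: "n \<in> mat_ker A" and S: "S \<in> support_sets q A"
  shows "supp (pos_part n) \<subseteq> S \<longleftrightarrow> supp (neg_part n) \<subseteq> S"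
proof -
  obtain p where p: "p \<in> closure (exp_family q A)" and Sp: "S = supp p"
    using S by (auto simp: support_sets_def)
  have q0: "q $ x \<noteq> 0" for x using q[of x] by simp
  have "{x. n $ x > 0} \<subseteq> S \<longleftrightarrow> (\<Prod>x | n $ x > 0. (p $ x / q $ x) powr (n $ x)) \<noteq> 0"
    by (auto simp: Sp supp_def q0)
  also have "\<dots> \<longleftrightarrow> {x. n $ x < 0} \<subseteq> S"
    unfolding closure_binomial_equation[OF q one n p] by (auto simp: Sp supp_def q0)
  finally show ?thesis by (simp add: supp_pos_part supp_neg_part)
qed

section \<open>Limits along a supporting functional\<close>

text \<open>Along the ray \<open>- k \<theta>\<close> the weight \<open>q x * exp (- k (\<theta> \<bullet> column x A))\<close> is constant for \<open>x\<close> in \<open>S\<close> and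
  tends to zero elsewhere; nonemptiness of \<open>S\<close> keeps the limit of the partition function
  positive.\<close>

lemma face_in_support_sets:
  fixes A :: "real ^ 'm::finite ^ 'd::finite"
  assumes q: "\<And>x. q $ x > 0" and "S \<noteq> {}"
    and zero: "\<And>x. x \<in> S \<Longrightarrow> \<theta> \<bullet> column x A = 0"
    and pos: "\<And>x. x \<notin> S \<Longrightarrow> \<theta> \<bullet> column x A > 0"
  shows "S \<in> support_sets q A"
proof -
  define w where "w x = (if x \<in> S then q $ x else 0)" for x
  define Z where "Z k = partition_fun q A (- real k *\<^sub>R \<theta>)" for k
  define f :: "nat \<Rightarrow> real ^ 'm"
    where "f k = (\<chi> x. q $ x / Z k * exp ((- real k *\<^sub>R \<theta>) \<bullet> column x A))" for k
  define p :: "real ^ 'm" where "p = (\<chi> x. w x / sum w UNIV)"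
  have Z_pos: "Z k > 0" for k
    unfolding Z_def by (rule partition_fun_pos[OF q])
  have "f k \<in> exp_family q A" for k
  proof -
    have "f k $ x = q $ x * exp ((- real k *\<^sub>R \<theta>) \<bullet> column x A) / Z k" for x
      by (simp add: f_def)
    then have "(\<Sum>x\<in>UNIV. f k $ x) = Z k / Z k"
      by (simp only: Z_def partition_fun_def flip: sum_divide_distrib)
    then show ?thesis
      using q Z_pos[of k]
      by (auto simp: exp_family_def prob_simplex_def f_def Z_def intro!: exI[of _ "- real k *\<^sub>R \<theta>"])
  qed
  moreover have "f \<longlonglongrightarrow> p"
  proof -
    have weight_lim: "(\<lambda>k. q $ x * exp ((- real k *\<^sub>R \<theta>) \<bullet> column x A)) \<longlonglongrightarrow> w x" for x
    proof (cases "x \<in> S")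
      case True
      then show ?thesis by (simp add: zero w_def)
    next
      case False
      define b where "b = exp (- (\<theta> \<bullet> column x A))"
      have "exp ((- real k *\<^sub>R \<theta>) \<bullet> column x A) = b ^ k" for k
        by (simp add: b_def flip: exp_of_nat_mult)
      moreover have "(\<lambda>k. b ^ k) \<longlonglongrightarrow> 0"
        by (rule LIMSEQ_power_zero) (simp add: b_def pos[OF False])
      ultimately show ?thesis
        using tendsto_mult_right_zero[of "\<lambda>k. b ^ k" sequentially "q $ x"]
        by (simp add: w_def False)
    qed
    then have Z_lim: "Z \<longlonglongrightarrow> sum w UNIV"
      unfolding Z_def partition_fun_def by (intro tendsto_sum)
    obtain s where "s \<in> S" using \<open>S \<noteq> {}\<close> by blast
    then have "sum w UNIV > 0"
      by (intro sum_pos2[of _ s]) (auto simp: w_def q less_imp_le)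
    then show ?thesis
      by (intro vec_tendstoI)
         (use tendsto_divide[OF weight_lim Z_lim] in \<open>simp add: f_def p_def\<close>)
  qed
  ultimately have "p \<in> closure (exp_family q A)"
    by (auto simp: closure_sequential)
  moreover have "supp p = S"
  proof -
    obtain s where "s \<in> S" using \<open>S \<noteq> {}\<close> by blast
    then have "sum w UNIV > 0"
      by (intro sum_pos2[of _ s]) (auto simp: w_def q less_imp_le)
    moreover have "q $ x \<noteq> 0" for x using q[of x] by simp
    ultimately show ?thesis by (auto simp: supp_def p_def w_def)
  qed
  ultimately show ?thesis by (auto simp: support_sets_def)
qed

section \<open>Theorem of the alternative\<close>

text \<open>The span of the columns in \<open>S\<close> is a closed subspace and the convex hull of the remaining
  columns is compact. A common point of the two is a linear relation between columns, that is, a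
  kernel vector of the required sign pattern; if there is none, a separating hyperplane supplies
  the functional. Both sets are written as images of sets of coefficient vectors, so that a common
  point yields the coefficients directly, also when columns coincide.\<close>

lemma face_functional_or_kernel_vector:
  fixes A :: "real ^ 'm::finite ^ 'd::finite"
  obtains (functional) \<theta> where "\<And>x. x \<in> S \<Longrightarrow> \<theta> \<bullet> column x A = 0"
      and "\<And>x. x \<notin> S \<Longrightarrow> \<theta> \<bullet> column x A > 0"
  | (kernel) n x where "n \<in> mat_ker A" "\<And>y. y \<notin> S \<Longrightarrow> n $ y \<ge> 0" "x \<notin> S" "n $ x > 0"
proof -
  define W :: "(real ^ 'm) set" where "W = {w. \<forall>x. x \<notin> S \<longrightarrow> w $ x = 0}"
  define K :: "(real ^ 'm) set" where "K = convex hull ((\<lambda>x. axis x 1) ` (- S))"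
  have linA: "linear ((*v) A)" by (rule matrix_vector_mul_linear)
  have subV: "subspace ((*v) A ` W)"
    by (rule linear_subspace_image[OF linA]) (auto simp: W_def subspace_def)
  have K_nonneg: "K \<subseteq> {k. (\<forall>x. k $ x \<ge> 0) \<and> (\<forall>x\<in>S. k $ x = 0) \<and> (\<Sum>x\<in>UNIV. k $ x) = 1}"
    unfolding K_def
  proof (rule hull_minimal)
    show "convex {k :: real ^ 'm. (\<forall>x. k $ x \<ge> 0) \<and> (\<forall>x\<in>S. k $ x = 0) \<and> (\<Sum>x\<in>UNIV. k $ x) = 1}"
      by (auto simp: convex_def sum.distrib simp flip: sum_distrib_left)
  qed (auto simp: axis_def)
  show thesis
  proof (cases "(*v) A ` W \<inter> (*v) A ` K = {}")
    case True
    have "compact ((*v) A ` K)"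
      unfolding K_def
      by (intro compact_continuous_image compact_convex_hull finite_imp_compact
          linear_continuous_on linear_conv_bounded_linear[THEN iffD1, OF linA]) auto
    moreover have "convex ((*v) A ` K)"
      by (intro convex_linear_image linA) (simp add: K_def)
    \<comment> \<open>The separation theorem wants a nonempty compact set; the remaining case is \<open>S = UNIV\<close>.\<close>
    moreover have "\<exists>\<theta> b. (\<forall>v\<in>(*v) A ` W. \<theta> \<bullet> v < b) \<and> (\<forall>v\<in>(*v) A ` K. \<theta> \<bullet> v > b)" if "K = {}"
      by (intro exI[of _ 0] exI[of _ 1]) (simp add: that)
    ultimately obtain \<theta> b where below: "\<And>v. v \<in> (*v) A ` W \<Longrightarrow> \<theta> \<bullet> v < b"
      and above: "\<And>v. v \<in> (*v) A ` K \<Longrightarrow> \<theta> \<bullet> v > b"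
      using separating_hyperplane_closed_compact[OF subspace_imp_convex[OF subV]
          closed_subspace[OF subV], of "(*v) A ` K"] True
      by (metis image_is_empty)
    have "b > 0" using below[OF subspace_0[OF subV]] by simp
    have col: "column x A = A *v axis x 1" for x
      by (simp add: matrix_vector_mult_basis)
    have zero: "\<theta> \<bullet> column x A = 0" if "x \<in> S" for x
    proof (rule ccontr)
      \<comment> \<open>A functional bounded above on a subspace vanishes on it: scaling the offending vector
        makes its value reach \<open>b\<close>.\<close>
      assume nz: "\<theta> \<bullet> column x A \<noteq> 0"
      have "column x A \<in> (*v) A ` W"
        unfolding col using that by (intro imageI) (auto simp: W_def axis_def)
      then have "\<theta> \<bullet> ((b / (\<theta> \<bullet> column x A)) *\<^sub>R column x A) < b"
        by (intro below subspace_scale[OF subV])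
      then show False using nz by simp
    qed
    have "\<theta> \<bullet> column x A > 0" if "x \<notin> S" for x
    proof -
      have "column x A \<in> (*v) A ` K"
        unfolding col K_def using that by (intro imageI hull_inc) auto
      then show ?thesis using above \<open>b > 0\<close> by fastforce
    qed
    with zero show thesis by (rule functional)
  next
    case False
    then obtain w k where w: "w \<in> W" and k: "k \<in> K" and eq: "A *v w = A *v k" by auto
    have ker: "k - w \<in> mat_ker A"
      by (simp add: mat_ker_def matrix_vector_mult_diff_distrib eq)
    have off: "(k - w) $ y = k $ y" if "y \<notin> S" for y
      using w that by (simp add: W_def)
    have k_nonneg: "k $ y \<ge> 0" and k_S: "x \<in> S \<Longrightarrow> k $ x = 0" for x y
      using k K_nonneg by auto
    have "\<exists>x. k $ x \<noteq> 0"
    proof (rule ccontr)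
      assume "\<nexists>x. k $ x \<noteq> 0"
      moreover have "(\<Sum>x\<in>UNIV. k $ x) = 1" using k K_nonneg by auto
      ultimately show False by simp
    qed
    then obtain x where x: "k $ x \<noteq> 0" by blast
    then have "x \<notin> S" using k_S by blast
    moreover from this have "(k - w) $ x > 0"
      using off x k_nonneg[of x] by simp
    ultimately show thesis
      using kernel[of "k - w" x] ker off k_nonneg by simp
  qed
qed

section \<open>From kernel vectors to circuits\<close>

text \<open>As in the simplex algorithm: \<open>t\<close> is the largest multiple of \<open>n'\<close> that can be subtracted before
  some coordinate outside \<open>S\<close> turns negative, and a coordinate attaining the minimal ratio drops
  to zero.\<close>

lemma ratio_test:
  fixes n n' :: "real ^ 'm::finite"
  assumes nonneg: "\<And>x. x \<notin> S \<Longrightarrow> n $ x \<ge> 0" and pos: "x \<notin> S" "n' $ x > 0"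
  obtains t y where "n' $ y > 0" "(n - t *\<^sub>R n') $ y = 0"
    "\<And>z. z \<notin> S \<Longrightarrow> (n - t *\<^sub>R n') $ z \<ge> 0"
proof -
  define P where "P = {x. x \<notin> S \<and> n' $ x > 0}"
  define r where "r x = n $ x / n' $ x" for x
  have "finite P" "P \<noteq> {}" using pos by (auto simp: P_def)
  then obtain y where y: "y \<in> P" and min: "\<And>z. z \<in> P \<Longrightarrow> r y \<le> r z"
    by (metis arg_min_if_finite(1) arg_min_least)
  have "(n - r y *\<^sub>R n') $ z \<ge> 0" if z: "z \<notin> S" for z
  proof (cases "n' $ z > 0")
    case True
    then have "r y \<le> n $ z / n' $ z" using min[of z] z by (simp add: P_def r_def)
    then show ?thesis using True by (simp add: field_simps)
  next
    case False
    moreover have "r y \<ge> 0" using y nonneg[of y] by (simp add: P_def r_def)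
    ultimately have "r y * n' $ z \<le> 0" by (simp add: mult_nonneg_nonpos)
    then show ?thesis using nonneg[OF z] by simp
  qed
  moreover have "(n - r y *\<^sub>R n') $ y = 0" using y by (simp add: P_def r_def)
  ultimately show thesis using that[of y "r y"] y by (simp add: P_def)
qed

text \<open>Take \<open>n\<close> of minimal support among the vectors described by the hypotheses. A nonzero kernel
  vector supported in \<open>supp n \<inter> S\<close> could be used to cancel a coordinate of \<open>n\<close> inside \<open>S\<close>, leaving \<open>n\<close>
  unchanged outside; so there is none. For an arbitrary kernel vector \<open>n'\<close> supported in \<open>supp n\<close>,
  the ratio test cancels a coordinate of \<open>n\<close> outside \<open>S\<close>; by minimality the remainder is supported
  in \<open>supp n \<inter> S\<close>, hence zero, and \<open>n\<close> is a multiple of \<open>n'\<close>.\<close>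

lemma circuit_of_kernel_vector:
  fixes A :: "real ^ 'm::finite ^ 'd::finite"
  assumes "n0 \<in> mat_ker A" "\<And>y. y \<notin> S \<Longrightarrow> n0 $ y \<ge> 0" "x0 \<notin> S" "n0 $ x0 > 0"
  obtains n where "circuit_vector A n" "supp (neg_part n) \<subseteq> S" "\<not> supp (pos_part n) \<subseteq> S"
proof -
  define good where "good n \<longleftrightarrow>
    n \<in> mat_ker A \<and> (\<forall>y. y \<notin> S \<longrightarrow> n $ y \<ge> 0) \<and> (\<exists>x. x \<notin> S \<and> n $ x > 0)" for n
  have "good n0" using assms by (auto simp: good_def)
  then obtain n where n: "good n" and "\<And>n'. good n' \<Longrightarrow> card (supp n) \<le> card (supp n')"
    using exists_least_lemma ex_has_least_nat[of good n0 "\<lambda>n. card (supp n)"] by blast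
  then have minimal: "\<not> good n'" if "supp n' \<subset> supp n" for n'
    using psubset_card_mono[OF _ that] by fastforce
  have ker: "n - t *\<^sub>R n' \<in> mat_ker A" if "n' \<in> mat_ker A" for n' t
    using n that
    by (simp add: good_def mat_ker_def matrix_vector_mult_diff_distrib matrix_vector_mult_scaleR)
  have cancel: "supp (n - t *\<^sub>R n') \<subset> supp n"
    if "supp n' \<subseteq> supp n" "n' $ y \<noteq> 0" "(n - t *\<^sub>R n') $ y = 0" for n' t y
    using that by (auto simp: supp_def)
  have inside: "n' = 0" if n': "n' \<in> mat_ker A" "supp n' \<subseteq> supp n" "supp n' \<subseteq> S" for n'
  proof (rule ccontr)
    assume "n' \<noteq> 0"
    then obtain y where y: "n' $ y \<noteq> 0" by (auto simp: vec_eq_iff)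
    define t where "t = n $ y / n' $ y"
    have "supp (n - t *\<^sub>R n') \<subset> supp n"
      by (rule cancel[OF n'(2) y]) (simp add: t_def y)
    moreover have "(n - t *\<^sub>R n') $ z = n $ z" if "z \<notin> S" for z
      using that n'(3) by (auto simp: supp_def)
    then have "good (n - t *\<^sub>R n')"
      using n ker[OF n'(1)] unfolding good_def by metis
    ultimately show False using minimal by blast
  qed
  have multiple: "\<exists>t. n = t *\<^sub>R n'"
    if n': "n' \<in> mat_ker A" "supp n' \<subseteq> supp n" and x: "x \<notin> S" "n' $ x > 0" for n' x
  proof -
    have "\<And>x. x \<notin> S \<Longrightarrow> n $ x \<ge> 0" using n by (simp add: good_def)
    from ratio_test[OF this x] obtain t y where y: "n' $ y > 0" "(n - t *\<^sub>R n') $ y = 0"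
      and nonneg: "\<And>z. z \<notin> S \<Longrightarrow> (n - t *\<^sub>R n') $ z \<ge> 0" by metis
    have smaller: "supp (n - t *\<^sub>R n') \<subset> supp n"
      by (rule cancel[OF n'(2) _ y(2)]) (use y in simp)
    then have "\<not> good (n - t *\<^sub>R n')" by (rule minimal)
    then have "(n - t *\<^sub>R n') $ z = 0" if "z \<notin> S" for z
      using ker[OF n'(1)] nonneg that unfolding good_def by (metis order_le_less)
    then have "supp (n - t *\<^sub>R n') \<subseteq> S" by (auto simp: supp_def)
    then have "n - t *\<^sub>R n' = 0"
      using inside[OF ker[OF n'(1)]] smaller by blast
    then show ?thesis by auto
  qed
  have "n \<noteq> 0" using n by (auto simp: good_def)
  have "\<exists>c. n' = c *\<^sub>R n" if n': "n' \<in> mat_ker A" "supp n' \<subseteq> supp n" for n'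
  proof (cases "supp n' \<subseteq> S")
    case True
    then have "n' = 0 *\<^sub>R n" using inside n' by simp
    then show ?thesis ..
  next
    case False
    then obtain x where x: "x \<notin> S" "n' $ x \<noteq> 0" by (auto simp: supp_def)
    have "\<exists>t. n = t *\<^sub>R n'"
    proof (cases "n' $ x > 0")
      case True
      then show ?thesis using multiple n' x by blast
    next
      case neg: False
      have "- n' \<in> mat_ker A"
        using n'(1) matrix_vector_mult_diff_distrib[of A 0 n'] by (simp add: mat_ker_def)
      moreover have "supp (- n') \<subseteq> supp n" using n'(2) by (simp add: supp_def)
      moreover have "(- n') $ x > 0" using neg x by simp
      ultimately obtain t where "n = t *\<^sub>R (- n')" using multiple x(1) by blast
      then have "n = (- t) *\<^sub>R n'" by simp
      then show ?thesis ..
    qed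
    then obtain t where t: "n = t *\<^sub>R n'" by blast
    with \<open>n \<noteq> 0\<close> have "n' = inverse t *\<^sub>R n" by auto
    then show ?thesis ..
  qed
  then have "circuit_vector A n"
    using n \<open>n \<noteq> 0\<close> by (auto simp: circuit_vector_def good_def)
  moreover have "supp (neg_part n) \<subseteq> S"
    using n by (force simp: good_def supp_neg_part)
  moreover have "\<not> supp (pos_part n) \<subseteq> S"
    using n by (auto simp: good_def supp_pos_part)
  ultimately show thesis by (rule that)
qed

section \<open>Characterisation of the support sets\<close>

theorem theorem18:
  fixes q :: "real ^ 'm::finite" and A :: "real ^ 'm ^ 'd::finite" and S :: "'m set"
  assumes "\<And>x. q $ x > 0"
    and "(\<chi> x. 1) \<in> span (rows A)"
    and "S \<noteq> {}"
  shows "S \<in> support_sets q A \<longleftrightarrow>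
    (\<forall>(M, N)\<in>signed_circuits A. M \<subseteq> S \<longleftrightarrow> N \<subseteq> S)"
proof
  assume "S \<in> support_sets q A"
  then show "\<forall>(M, N)\<in>signed_circuits A. M \<subseteq> S \<longleftrightarrow> N \<subseteq> S"
    using support_sets_kernel_condition[OF assms(1,2)]
    by (auto simp: signed_circuits_def sgn_pair_def circuit_vector_def)
next
  assume circuits: "\<forall>(M, N)\<in>signed_circuits A. M \<subseteq> S \<longleftrightarrow> N \<subseteq> S"
  show "S \<in> support_sets q A"
  proof (cases rule: face_functional_or_kernel_vector[of S A])
    case (functional \<theta>)
    then show ?thesis by (rule face_in_support_sets[OF assms(1,3)])
  next
    case (kernel n x)
    then obtain c where "circuit_vector A c"
      and "supp (neg_part c) \<subseteq> S" "\<not> supp (pos_part c) \<subseteq> S"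
      by (rule circuit_of_kernel_vector)
    moreover from this have "(supp (pos_part c), supp (neg_part c)) \<in> signed_circuits A"
      by (auto simp: signed_circuits_def sgn_pair_def)
    ultimately show ?thesis using circuits by blast
  qed
qed

end
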